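(* Let $p(x)$ and $r(x)$ be functions that are continuous at zero. Let $y(x)$ be any solution of the second-order $q$-difference equation $$\frac{1}{q}D_{q^{-1}}D_q y(x)+p(x)D_{q}y(x)+r(x)y(x)=0 .$$ Let $h(x)$ be an arbitrary function and let $f(x)$ be a solution of the first-order $q$-difference equation $$D_{q}f(x)=p(x)f(x).$$ Then $$\int f(x)\Big(\frac1q D_{q^{-1}}D_qh(x)+p(x)D_{q}h(x)+r(x)h(x)\Big)y(x)\,d_qx=f(x)\Big(y(x)\,D_{q^{-1}}h(x)-h(x)\,D_{q^{-1}}y(x)\Big).$$
   Context: Here $0<q<1$. All functions are complex-valued, defined on a set $A$ with $0\in A$ such that $x\in A$ implies $qx\in A$ and $x/q\in A$. The $q$-derivative is $D_qf(x)=\frac{f(x)-f(qx)}{(1-q)x}$ for $x\ne0$ (and $D_qf(0)=f'(0)$ if this exists); $D_{q^{-1}}$ is the same operator with $q$ replaced by $q^{-1}$, i.e. $D_{q^{-1}}f(x)=\frac{f(x)-f(x/q)}{(1-q^{-1})x}$ for $x\neq0$. An indefinite $q$-integral identity $\int F(x)\,d_qx=G(x)$ means that $G$ is a $q$-antiderivative of $F$: $D_qG(x)=F(x)$ for all nonzero $x$ in the domain. The $q$-difference equations are likewise understood at nonzero $x$. *)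

theory Defs
  imports Complex_Main
begin

definition q_geometric :: "real \<Rightarrow> complex set \<Rightarrow> bool" where
  "q_geometric q A \<longleftrightarrow>
     0 \<in> A \<and> (\<forall>x\<in>A. of_real q * x \<in> A \<and> x / of_real q \<in> A)"

(* A function on A is represented by a total function of which only the values on A matter.
   Accordingly the derivative at 0 is taken within A; it is unspecified if f is not
   differentiable at 0. *)
definition q_deriv :: "complex set \<Rightarrow> real \<Rightarrow> (complex \<Rightarrow> complex) \<Rightarrow> complex \<Rightarrow> complex" where
  "q_deriv A q f x =
     (if x = 0 then (SOME d. (f has_field_derivative d) (at 0 within A))
      else (f x - f (of_real q * x)) / ((1 - of_real q) * x))"

(* The indefinite q-integral identity \<integral> F(x) d_q x = G(x) on A. *)
definition has_q_antiderivative ::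
    "complex set \<Rightarrow> real \<Rightarrow> (complex \<Rightarrow> complex) \<Rightarrow> (complex \<Rightarrow> complex) \<Rightarrow> bool" where
  "has_q_antiderivative A q F G \<longleftrightarrow> (\<forall>x\<in>A - {0}. q_deriv A q G x = F x)"

end

theory Submission
  imports Defs
begin

text \<open>
  The claim is the Lagrange identity of the operator
  \<open>L h = (1/q) D\<^bsub>1/q\<^esub> D\<^bsub>q\<^esub> h + p D\<^bsub>q\<^esub> h + r h\<close>: the function \<open>f\<close> is its integrating factor, and
  \<open>W = y D\<^bsub>1/q\<^esub> h - h D\<^bsub>1/q\<^esub> y\<close> is a \<open>q\<close>-Wronskian.

  Since \<open>D\<^bsub>1/q\<^esub> h\<close> is \<open>D\<^bsub>q\<^esub> h\<close> shifted by one step (\<open>q_deriv_inverse_shift\<close>), the leading term of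
  \<open>L h\<close> equals \<open>D\<^bsub>q\<^esub> D\<^bsub>1/q\<^esub> h\<close> (\<open>q_deriv_inverse_commute\<close>), and \<open>W(qx)\<close> is the Wronskian
  \<open>y D\<^bsub>q\<^esub> h - h D\<^bsub>q\<^esub> y\<close> at \<open>x\<close> (\<open>q_wronskian_shift\<close>). As for ordinary derivatives, the products of
  first derivatives cancel in \<open>D\<^bsub>q\<^esub> W\<close>, so that
  \<open>D\<^bsub>q\<^esub> W = y D\<^bsub>q\<^esub> D\<^bsub>1/q\<^esub> h - h D\<^bsub>q\<^esub> D\<^bsub>1/q\<^esub> y\<close> (\<open>q_deriv_wronskian\<close>).
  The \<open>q\<close>-product rule puts the derivative of \<open>f\<close> in front of the shifted \<open>W(qx)\<close>, and
  \<open>D\<^bsub>q\<^esub> f = p f\<close> turns this into exactly the first-order terms of \<open>L\<close>. The terms in \<open>r\<close> cancel, whence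
  \<open>D\<^bsub>q\<^esub> (f W) = f (y L h - h L y)\<close>, and \<open>L y = 0\<close>.
\<close>

lemma q_deriv_mult:
  assumes "x \<noteq> 0"
  shows "q_deriv A q (\<lambda>t. f t * g t) x =
    f x * q_deriv A q g x + g (of_real q * x) * q_deriv A q f x"
  using assms by (simp add: q_deriv_def add_divide_distrib [symmetric] algebra_simps)

text \<open>
  Both sides are the difference quotient of \<open>h\<close> between the points \<open>x\<close> and \<open>q x\<close>, read from
  opposite ends.
\<close>
lemma q_deriv_inverse_shift:
  assumes "q \<noteq> 0" "x \<noteq> 0"
  shows "q_deriv A (inverse q) h (of_real q * x) = q_deriv A q h x"
proof -
  have "(1 - of_real (inverse q)) * (of_real q * x) = - ((1 - of_real q) * x)"
    using assms by (simp add: field_simps)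
  then show ?thesis
    using assms by (simp add: q_deriv_def minus_divide_left mult.assoc [symmetric])
qed

text \<open>
  The factor \<open>1/q\<close> in the equation compensates for \<open>D\<^bsub>1/q\<^esub>\<close> dividing by \<open>(1 - 1/q) x\<close>: since
  \<open>q (1 - 1/q) = -(1 - q)\<close>, both sides compare \<open>D\<^bsub>q\<^esub> h\<close> at \<open>x / q\<close> and at \<open>x\<close>.
\<close>
lemma q_deriv_inverse_commute:
  assumes "q \<noteq> 0" "x \<noteq> 0"
  shows "1 / of_real q * q_deriv A (inverse q) (q_deriv A q h) x =
    q_deriv A q (q_deriv A (inverse q) h) x"
proof -
  let ?D = "q_deriv A q h"
  have shift: "q_deriv A (inverse q) h x = ?D (x / of_real q)"
    using q_deriv_inverse_shift [of q "x / of_real q" A h] assms by simp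
  have denom: "of_real q * ((1 - of_real (inverse q)) * x) = - ((1 - of_real q) * x)"
    using assms by (simp add: field_simps)
  have "1 / of_real q * q_deriv A (inverse q) ?D x =
      (?D x - ?D (x / of_real q)) / (of_real q * ((1 - of_real (inverse q)) * x))"
    using assms by (simp add: q_deriv_def [of A "inverse q" ?D] divide_inverse mult.commute)
  also have "\<dots> = (?D (x / of_real q) - ?D x) / ((1 - of_real q) * x)"
    by (simp only: denom divide_minus_right minus_divide_left minus_diff_eq)
  also have "\<dots> = q_deriv A q (q_deriv A (inverse q) h) x"
    using assms
    by (simp add: q_deriv_def [of A q "q_deriv A (inverse q) h"] shift q_deriv_inverse_shift)
  finally show ?thesis .
qed

definition q_wronskian ::
    "complex set \<Rightarrow> real \<Rightarrow> (complex \<Rightarrow> complex) \<Rightarrow> (complex \<Rightarrow> complex) \<Rightarrow> complex \<Rightarrow> complex" where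
  "q_wronskian A q y h x = y x * q_deriv A q h x - h x * q_deriv A q y x"

text \<open>
  The shift turns the derivatives into \<open>D\<^bsub>q\<^esub> h(x)\<close> and \<open>D\<^bsub>q\<^esub> y(x)\<close>, but leaves the factors \<open>y\<close> and \<open>h\<close>
  evaluated at \<open>q x\<close>. Moving these back to \<open>x\<close> by \<open>y(x) - y(qx) = (1 - q) x D\<^bsub>q\<^esub> y(x)\<close> produces the
  same product \<open>D\<^bsub>q\<^esub> y(x) D\<^bsub>q\<^esub> h(x)\<close> twice, with opposite signs.
\<close>
lemma q_wronskian_shift:
  assumes "q \<noteq> 0" "x \<noteq> 0"
  shows "q_wronskian A (inverse q) y h (of_real q * x) = q_wronskian A q y h x"
proof -
  have "q_wronskian A (inverse q) y h (of_real q * x) =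
      y (of_real q * x) * q_deriv A q h x - h (of_real q * x) * q_deriv A q y x"
    using assms by (simp add: q_wronskian_def q_deriv_inverse_shift)
  also have "\<dots> = q_wronskian A q y h x"
    using assms
    by (simp add: q_wronskian_def q_deriv_def diff_divide_distrib [symmetric] algebra_simps)
  finally show ?thesis .
qed

lemma q_deriv_wronskian:
  assumes "q \<noteq> 0" "x \<noteq> 0"
  shows "q_deriv A q (q_wronskian A (inverse q) y h) x =
    y x * q_deriv A q (q_deriv A (inverse q) h) x -
    h x * q_deriv A q (q_deriv A (inverse q) y) x"
proof -
  let ?W = "q_wronskian A (inverse q) y h"
  have "?W x - ?W (of_real q * x) =
      y x * (q_deriv A (inverse q) h x - q_deriv A (inverse q) h (of_real q * x)) -
      h x * (q_deriv A (inverse q) y x - q_deriv A (inverse q) y (of_real q * x))"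
    unfolding q_wronskian_shift [OF assms] q_deriv_inverse_shift [OF assms]
    by (simp add: q_wronskian_def algebra_simps)
  then show ?thesis
    using assms
    by (simp add: q_deriv_def [of A q ?W] q_deriv_def [of A q "q_deriv A (inverse q) h"]
        q_deriv_def [of A q "q_deriv A (inverse q) y"] diff_divide_distrib
        right_diff_distrib)
qed

theorem theorem2p2:
  fixes q :: real and A :: "complex set" and p r y h f :: "complex \<Rightarrow> complex"
  assumes "0 < q" and "q < 1"
    and "q_geometric q A"
    and "continuous (at 0 within A) p" and "continuous (at 0 within A) r"
    and "\<And>x. x \<in> A \<Longrightarrow> x \<noteq> 0 \<Longrightarrow>
      1 / of_real q * q_deriv A (inverse q) (q_deriv A q y) x + p x * q_deriv A q y x + r x * y x = 0"
    and "\<And>x. x \<in> A \<Longrightarrow> x \<noteq> 0 \<Longrightarrow> q_deriv A q f x = p x * f x"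
  shows "has_q_antiderivative A q
    (\<lambda>x. f x * (1 / of_real q * q_deriv A (inverse q) (q_deriv A q h) x
                 + p x * q_deriv A q h x + r x * h x) * y x)
    (\<lambda>x. f x * (y x * q_deriv A (inverse q) h x - h x * q_deriv A (inverse q) y x))"
  unfolding has_q_antiderivative_def q_wronskian_def [symmetric]
proof
  fix x assume "x \<in> A - {0}"
  then have x: "x \<in> A" "x \<noteq> 0" by auto
  have q: "q \<noteq> 0" using \<open>0 < q\<close> by simp
  define Dh where "Dh = q_deriv A q h x"
  define Dy where "Dy = q_deriv A q y x"
  define DDh where "DDh = 1 / of_real q * q_deriv A (inverse q) (q_deriv A q h) x"
  define DDy where "DDy = 1 / of_real q * q_deriv A (inverse q) (q_deriv A q y) x"
  have Ly: "DDy + p x * Dy + r x * y x = 0"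
    unfolding DDy_def Dy_def using assms(6) [OF x] .
  have "q_deriv A q (\<lambda>x. f x * q_wronskian A (inverse q) y h x) x =
      f x * (y x * DDh - h x * DDy) + (y x * Dh - h x * Dy) * (p x * f x)"
    unfolding q_deriv_mult [OF x(2)] q_wronskian_shift [OF q x(2)] q_deriv_wronskian [OF q x(2)]
      assms(7) [OF x] DDh_def DDy_def q_deriv_inverse_commute [OF q x(2)]
    by (simp add: q_wronskian_def Dh_def Dy_def)
  also have "\<dots> = f x * (DDh + p x * Dh + r x * h x) * y x
      - f x * h x * (DDy + p x * Dy + r x * y x)"
    by (simp add: algebra_simps)
  also have "\<dots> = f x * (DDh + p x * Dh + r x * h x) * y x"
    by (simp add: Ly)
  finally show "q_deriv A q (\<lambda>x. f x * q_wronskian A (inverse q) y h x) x =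
      f x * (1 / of_real q * q_deriv A (inverse q) (q_deriv A q h) x
        + p x * q_deriv A q h x + r x * h x) * y x"
    unfolding DDh_def Dh_def .
qed

end
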